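(* Let $\mathcal H$ be a complex, separable, infinite-dimensional Hilbert space, let $n\ge2$ be an integer and suppose that $T\in\mathcal B(\mathcal H)$ is $\textsc{j}_n^{[\textsc{u}]}$-stable, i.e. $T$ is unitarily equivalent to $J_n(T)$. Then either (a) $T$ is invertible and $\sigma(T)=\mathbb T$; or (b) $T$ is not invertible and $\sigma(T)=\overline{\mathbb D}$.
   Context: $\mathbb T=\{z\in\mathbb C:|z|=1\}$, $\mathbb D=\{z\in\mathbb C:|z|<1\}$; $\sigma(T)$ is the spectrum. For $T\in\mathcal B(\mathcal H)$ and $n\ge2$, $J_n(T)\in\mathcal B(\mathcal H^{(n)})$ (where $\mathcal H^{(n)}$ is the direct sum of $n$ copies of $\mathcal H$) is the $n\times n$ operator matrix with $I$ in each entry $(i,i+1)$, $1\le i\le n-1$, with $T$ in the entry $(n,1)$, and $0$ elsewhere. Operators $X,Y$ on Hilbert spaces are unitarily equivalent if $Y=V^*XV$ for some unitary $V$ between the underlying spaces. *)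

theory Defs
  imports "HOL-Analysis.Analysis"
begin

text \<open>
  Complex inner product spaces. The class extends \<open>real_inner\<close>, so norm and topology are the
  library's; axiom \<open>inner_eq_Re_cinner\<close> makes them the ones induced by \<open>cinner\<close>, because
  \<open>norm x = sqrt (inner x x)\<close> and \<open>cinner x x\<close> is real. Positive definiteness of \<open>cinner\<close> is
  inherited from \<open>inner\<close>. The inner product is linear in its first argument.
\<close>

class complex_inner = real_inner +
  fixes scaleC :: "complex \<Rightarrow> 'a \<Rightarrow> 'a"  (infixr \<open>*\<^sub>C\<close> 75)
    and cinner :: "'a \<Rightarrow> 'a \<Rightarrow> complex"
  assumes scaleC_add_right: "a *\<^sub>C (x + y) = a *\<^sub>C x + a *\<^sub>C y"
    and scaleC_add_left: "(a + b) *\<^sub>C x = a *\<^sub>C x + b *\<^sub>C x"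
    and scaleC_scaleC: "a *\<^sub>C b *\<^sub>C x = (a * b) *\<^sub>C x"
    and scaleC_of_real: "complex_of_real r *\<^sub>C x = r *\<^sub>R x"
    and cinner_commute: "cinner x y = cnj (cinner y x)"
    and cinner_add_left: "cinner (x + y) z = cinner x z + cinner y z"
    and cinner_scaleC_left: "cinner (a *\<^sub>C x) y = a * cinner x y"
    and inner_eq_Re_cinner: "inner x y = Re (cinner x y)"

class chilbert_space = complex_inner + complete_space

lemma scaleC_one: "1 *\<^sub>C x = (x :: 'a :: complex_inner)"
  using scaleC_of_real[of 1 x] by simp

lemma norm_eq_sqrt_cinner: "norm x = sqrt (Re (cinner x x))"
  by (simp add: norm_eq_sqrt_inner inner_eq_Re_cinner)

lemma cinner_self: "cinner x x = complex_of_real ((norm x)\<^sup>2)"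
proof -
  have "Im (cinner x x) = 0"
    using arg_cong[OF cinner_commute[of x x], of Im] by simp
  moreover have "Re (cinner x x) = (norm x)\<^sup>2"
    by (simp add: power2_norm_eq_inner inner_eq_Re_cinner)
  ultimately show ?thesis
    by (simp add: complex_eq_iff)
qed

global_interpretation complex_vector: vector_space "scaleC :: complex \<Rightarrow> 'a \<Rightarrow> 'a :: complex_inner"
  defines cspan = complex_vector.span
  by standard (simp_all add: scaleC_add_right scaleC_add_left scaleC_scaleC scaleC_one)

text \<open>The direct sum of \<open>CARD('n)\<close> copies of \<open>'a\<close>.\<close>

instantiation vec :: (complex_inner, finite) complex_inner
begin

definition "scaleC c x = (\<chi> i. c *\<^sub>C (x $ i))"

definition "cinner x y = (\<Sum>i\<in>UNIV. cinner (x $ i) (y $ i))"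

instance
proof
  fix x y z :: "'a ^ 'b" and a b :: complex and r :: real
  show "cinner x y = cnj (cinner y x)"
    unfolding cinner_vec_def cnj_sum by (rule sum.cong[OF refl], rule cinner_commute)
  show "inner x y = Re (cinner x y)"
    by (simp add: inner_vec_def cinner_vec_def inner_eq_Re_cinner)
qed (simp_all add: vec_eq_iff scaleC_vec_def cinner_vec_def scaleC_add_right scaleC_add_left
      scaleC_scaleC scaleC_of_real cinner_add_left cinner_scaleC_left sum.distrib sum_distrib_left)

end

instance vec :: (chilbert_space, finite) chilbert_space ..

definition infinite_cdim :: "'a :: complex_inner itself \<Rightarrow> bool" where
  "infinite_cdim _ \<longleftrightarrow> \<not> (\<exists>B :: 'a set. finite B \<and> cspan B = UNIV)"

text \<open>Elements of $\mathcal{B}(\mathcal{H},\mathcal{K})$ are the functions satisfying this predicate.\<close>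

definition bounded_clinear :: "('a :: complex_inner \<Rightarrow> 'b :: complex_inner) \<Rightarrow> bool" where
  "bounded_clinear T \<longleftrightarrow> bounded_linear T \<and> (\<forall>c x. T (c *\<^sub>C x) = c *\<^sub>C T x)"

definition op_invertible :: "('a :: complex_inner \<Rightarrow> 'a) \<Rightarrow> bool" where
  "op_invertible T \<longleftrightarrow> (\<exists>S. bounded_clinear S \<and> S \<circ> T = id \<and> T \<circ> S = id)"

definition op_spectrum :: "('a :: complex_inner \<Rightarrow> 'a) \<Rightarrow> complex set" where
  "op_spectrum T = {z. \<not> op_invertible (\<lambda>x. T x - z *\<^sub>C x)}"

definition is_cadjoint ::
    "('a :: complex_inner \<Rightarrow> 'b :: complex_inner) \<Rightarrow> ('b \<Rightarrow> 'a) \<Rightarrow> bool" where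
  "is_cadjoint V W \<longleftrightarrow> (\<forall>x y. cinner (V x) y = cinner x (W y))"

definition cadjoint :: "('a :: complex_inner \<Rightarrow> 'b :: complex_inner) \<Rightarrow> 'b \<Rightarrow> 'a" where
  "cadjoint V = (THE W. is_cadjoint V W)"

lemma cadjoint_eqI:
  assumes "is_cadjoint V W"
  shows "cadjoint V = W"
  unfolding cadjoint_def
proof (rule the_equality, rule assms, rule ext)
  fix W' y
  assume "is_cadjoint V W'"
  with assms have "cinner x (W y) = cinner x (W' y)" for x
    by (metis is_cadjoint_def)
  then have "inner x (W y) = inner x (W' y)" for x
    by (simp add: inner_eq_Re_cinner)
  then show "W' y = W y"
    using vector_eq_ldot[of "W y" "W' y"] by simp
qed

text \<open>
  On Hilbert spaces every bounded operator has an adjoint, so the second conjunct only says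
  explicitly that the description defining \<open>cadjoint V\<close> is proper.
\<close>

definition cunitary :: "('a :: chilbert_space \<Rightarrow> 'b :: chilbert_space) \<Rightarrow> bool" where
  "cunitary V \<longleftrightarrow> bounded_clinear V \<and> is_cadjoint V (cadjoint V) \<and>
     cadjoint V \<circ> V = id \<and> V \<circ> cadjoint V = id"

definition unitarily_equivalent ::
    "('a :: chilbert_space \<Rightarrow> 'a) \<Rightarrow> ('b :: chilbert_space \<Rightarrow> 'b) \<Rightarrow> bool" where
  "unitarily_equivalent X Y \<longleftrightarrow> (\<exists>V :: 'b \<Rightarrow> 'a. cunitary V \<and> Y = cadjoint V \<circ> X \<circ> V)"

text \<open>
  \<open>pos\<close> numbers a finite linearly ordered index type increasingly by \<open>1, \<dots>, n\<close>, where
  \<open>n = CARD('n)\<close>; the entry \<open>(i, j)\<close> of a matrix is the one at indices with these numbers.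
\<close>

definition pos :: "'n :: {finite, linorder} \<Rightarrow> nat" where
  "pos i = card {..i}"

lemma pos_strict_mono: "strict_mono (pos :: 'n :: {finite, linorder} \<Rightarrow> nat)"
  unfolding strict_mono_def pos_def by (auto intro!: psubset_card_mono)

lemma bij_betw_pos: "bij_betw pos (UNIV :: 'n :: {finite, linorder} set) {1..CARD('n)}"
proof -
  have inj: "inj (pos :: 'n \<Rightarrow> nat)"
    by (rule strict_mono_imp_inj_on[OF pos_strict_mono])
  have "pos i \<in> {1..CARD('n)}" for i :: 'n
    by (auto simp: pos_def Suc_le_eq card_gt_0_iff intro!: card_mono)
  then have "range (pos :: 'n \<Rightarrow> nat) = {1..CARD('n)}"
    using inj by (intro card_subset_eq) (auto simp: card_image)
  with inj show ?thesis
    by (simp add: bij_betw_def)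
qed

definition J_entry :: "('a :: complex_inner \<Rightarrow> 'a) \<Rightarrow> 'n :: {finite, linorder} \<Rightarrow> 'n \<Rightarrow> 'a \<Rightarrow> 'a" where
  "J_entry T i j =
     (if pos j = pos i + 1 then (\<lambda>x. x)
      else if pos i = CARD('n) \<and> pos j = 1 then T
      else (\<lambda>x. 0))"

definition J_op :: "('a :: complex_inner \<Rightarrow> 'a) \<Rightarrow> ('a, 'n :: {finite, linorder}) vec \<Rightarrow> ('a, 'n) vec" where
  "J_op T x = (\<chi> i. \<Sum>j\<in>UNIV. J_entry T i j (x $ j))"

end

theory Submission
  imports Defs
begin

text \<open>
  Eliminating all components but the first from \<open>(J - z) v = w\<close> shows that \<open>J - z\<close> and \<open>T - z\<^sup>n\<close>
  are invertible together; as \<open>T\<close> and \<open>J\<close> are unitarily equivalent, the spectrum of \<open>T\<close> is fully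
  invariant under \<open>z \<mapsto> z\<^sup>n\<close>. Iterating this map pushes a point with \<open>\<bar>z\<bar> > 1\<close> beyond the norm of
  \<open>T\<close>, so no such point is in the spectrum. If \<open>\<bar>z\<bar> < 1\<close> the iterates tend to \<open>0\<close>, while a lower
  bound of \<open>T - z\<close> persists along them; hence \<open>z\<close> is in the spectrum exactly if \<open>0\<close> is. If
  \<open>\<bar>z\<bar> = 1\<close> a lower bound of \<open>(T - z)\<^sup>2\<close> is multiplied by \<open>n\<close> at each iteration, which contradicts
  the boundedness of \<open>T\<close>, so the whole circle is in the spectrum.
\<close>

section \<open>Lower bounds, invertibility and perturbation of operators\<close>

lemma norm_scaleC: "norm (c *\<^sub>C x) = cmod c * norm (x :: 'a :: complex_inner)"
proof -
  have "complex_of_real ((norm (c *\<^sub>C x))\<^sup>2) = c * cnj (c * cinner x x)"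
    by (metis cinner_self cinner_scaleC_left cinner_commute)
  also have "\<dots> = complex_of_real ((cmod c * norm x)\<^sup>2)"
    using complex_norm_square[of c] by (simp add: cinner_self power_mult_distrib)
  finally have "(norm (c *\<^sub>C x))\<^sup>2 = (cmod c * norm x)\<^sup>2"
    using of_real_eq_iff by blast
  then show ?thesis by simp
qed

lemma bounded_clinear_scaleC: "bounded_clinear (\<lambda>x :: 'a :: complex_inner. c *\<^sub>C x)"
  unfolding bounded_clinear_def
proof (intro conjI allI)
  show "bounded_linear (\<lambda>x :: 'a. c *\<^sub>C x)"
  proof (rule bounded_linear_intro[where K = "cmod c"])
    show "c *\<^sub>C (r *\<^sub>R x) = r *\<^sub>R (c *\<^sub>C x)" for r and x :: 'a
      by (simp add: scaleC_scaleC mult.commute flip: scaleC_of_real)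
  qed (simp_all add: scaleC_add_right norm_scaleC)
  show "c *\<^sub>C a *\<^sub>C x = a *\<^sub>C c *\<^sub>C x" for a and x :: 'a
    by (simp add: scaleC_scaleC mult.commute)
qed

lemma bounded_clinear_diff:
  assumes "bounded_clinear S" "bounded_clinear T"
  shows "bounded_clinear (\<lambda>x. S x - T x)"
  using assms by (auto simp: bounded_clinear_def bounded_linear_sub complex_vector.scale_right_diff_distrib)

lemma bounded_clinear_shift:
  "bounded_clinear T \<Longrightarrow> bounded_clinear (\<lambda>x. T x - z *\<^sub>C x)"
  by (intro bounded_clinear_diff bounded_clinear_scaleC)

definition bounded_below :: "real \<Rightarrow> ('a :: complex_inner \<Rightarrow> 'b :: complex_inner) \<Rightarrow> bool" where
  "bounded_below c T \<longleftrightarrow> c > 0 \<and> (\<forall>x. c * norm x \<le> norm (T x))"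

text \<open>A lower bound \<open>c\<close> forces injectivity and bounds the inverse by
  \<open>1 / c\<close>; conversely a bound \<open>K\<close> of the inverse gives the lower bound
  \<open>1 / K\<close>.\<close>

lemma op_invertible_iff:
  assumes T: "bounded_clinear T"
  shows "op_invertible T \<longleftrightarrow> (\<exists>c. bounded_below c T) \<and> surj T"
proof
  assume "op_invertible T"
  then obtain S where S: "bounded_clinear S" "S \<circ> T = id" "T \<circ> S = id"
    by (auto simp: op_invertible_def)
  obtain K where K: "K > 0" "\<And>x. norm (S x) \<le> norm x * K"
    using S(1) bounded_linear.pos_bounded unfolding bounded_clinear_def by blast
  have "(1 / K) * norm x \<le> norm (T x)" for x
    using K(2)[of "T x"] K(1) pointfree_idE[OF S(2), of x] by (simp add: field_simps)
  then have "bounded_below (1 / K) T"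
    using K(1) by (simp add: bounded_below_def)
  moreover have "surj T"
    using S(3) by (metis pointfree_idE surjI)
  ultimately show "(\<exists>c. bounded_below c T) \<and> surj T" by blast
next
  assume "(\<exists>c. bounded_below c T) \<and> surj T"
  then obtain c where c: "c > 0" "\<And>x. c * norm x \<le> norm (T x)" and surj: "surj T"
    by (auto simp: bounded_below_def)
  interpret T: bounded_linear T
    using T by (simp add: bounded_clinear_def)
  have "x = y" if "T x = T y" for x y
  proof -
    have "c * norm (x - y) \<le> 0"
      using c(2)[of "x - y"] that by (simp add: T.diff)
    then show ?thesis
      using c(1) by (simp add: mult_le_0_iff)
  qed
  then have inj: "inj T" by (rule injI)
  have TS: "T (inv T y) = y" for y
    by (rule surj_f_inv_f[OF surj])
  have eq: "inv T y = x" if "T x = y" for x y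
    using inj that by auto
  have "bounded_linear (inv T)"
  proof (rule bounded_linear_intro[where K = "1 / c"])
    show "norm (inv T y) \<le> norm y * (1 / c)" for y
      using c(2)[of "inv T y"] c(1) by (simp add: TS field_simps)
  qed (auto intro!: eq simp: T.add T.scale TS)
  moreover have "inv T (a *\<^sub>C y) = a *\<^sub>C inv T y" for a y
    using T by (intro eq) (simp add: bounded_clinear_def TS)
  ultimately have "bounded_clinear (inv T)"
    by (simp add: bounded_clinear_def)
  then show "op_invertible T"
    unfolding op_invertible_def using inj TS by (intro exI[of _ "inv T"]) auto
qed

text \<open>Solving \<open>S x - A x = y\<close> means finding a fixed point of
  \<open>x \<mapsto> inv S (y + A x)\<close>, a contraction of ratio \<open>a / c\<close>; Banach's
  theorem gives surjectivity.\<close>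

lemma op_invertible_diff:
  fixes S :: "'a :: chilbert_space \<Rightarrow> 'a"
  assumes S: "bounded_clinear S" "surj S" "bounded_below c S"
    and A: "bounded_clinear A" "\<And>x. norm (A x) \<le> a * norm x" "a < c"
  shows "op_invertible (\<lambda>x. S x - A x)"
proof -
  interpret S: bounded_linear S
    using S(1) by (simp add: bounded_clinear_def)
  interpret A: bounded_linear A
    using A(1) by (simp add: bounded_clinear_def)
  have c: "c > 0" "\<And>x. c * norm x \<le> norm (S x)"
    using S(3) by (auto simp: bounded_below_def)
  have "(c - a) * norm x \<le> norm (S x - A x)" for x
    using c(2)[of x] A(2)[of x] norm_triangle_ineq2[of "S x" "A x"] by (simp add: algebra_simps)
  then have "bounded_below (c - a) (\<lambda>x. S x - A x)"
    using A(3) by (simp add: bounded_below_def)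
  moreover have "surj (\<lambda>x. S x - A x)"
    unfolding surj_def
proof
    fix y
    define g where "g x = inv S (y + A x)" for x
    have Sg: "S (g x) = y + A x" for x
      unfolding g_def by (rule surj_f_inv_f[OF S(2)])
    \<comment> \<open>The maximum keeps the contraction constant nonnegative even if
      \<open>a\<close> is negative.\<close>
    have "dist (g x) (g x') \<le> max 0 (a / c) * dist x x'" for x x'
    proof -
      have "c * norm (g x - g x') \<le> norm (A (x - x'))"
        using c(2)[of "g x - g x'"] by (simp add: S.diff Sg A.diff)
      also have "\<dots> \<le> a * norm (x - x')" by (rule A(2))
      finally have "norm (g x - g x') \<le> (a / c) * norm (x - x')"
        using c(1) by (simp add: field_simps)
      also have "\<dots> \<le> max 0 (a / c) * norm (x - x')"
        by (intro mult_right_mono) auto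
      finally show ?thesis by (simp add: dist_norm)
    qed
    then obtain x where "g x = x"
      using banach_fix_type[of "max 0 (a / c)" g] c(1) A(3) by auto
    then have "y = S x - A x"
      using Sg[of x] by simp
    then show "\<exists>x. y = S x - A x" ..
  qed
  ultimately show ?thesis
    using op_invertible_iff[OF bounded_clinear_diff[OF S(1) A(1)]] by blast
qed

lemma op_invertible_shift_bounded_below:
  fixes S :: "'a :: chilbert_space \<Rightarrow> 'a"
  assumes "bounded_clinear S" "surj S" "bounded_below c S" "cmod z < c"
  shows "op_invertible (\<lambda>x. S x - z *\<^sub>C x)"
  using assms by (intro op_invertible_diff[OF _ _ _ bounded_clinear_scaleC]) (auto simp: norm_scaleC)

text \<open>T - z is read as (-z) - (-T): the dominant operator is the scalar -z, with lower bound
  |z|.\<close>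

lemma op_invertible_shift_large:
  fixes T :: "'a :: chilbert_space \<Rightarrow> 'a"
  assumes T: "bounded_clinear T" "\<And>x. norm (T x) \<le> K * norm x" and z: "z \<noteq> 0" "K < cmod z"
  shows "op_invertible (\<lambda>x. T x - z *\<^sub>C x)"
proof -
  have "surj (\<lambda>x :: 'a. (- z) *\<^sub>C x)"
    using z by (intro surjI[where f = "\<lambda>x. (- 1 / z) *\<^sub>C x"])
      (simp add: scaleC_scaleC scaleC_one del: complex_vector.scale_minus_left)
  moreover have "bounded_below (cmod z) (\<lambda>x :: 'a. (- z) *\<^sub>C x)"
    using z by (simp add: bounded_below_def norm_scaleC del: complex_vector.scale_minus_left)
  moreover have "bounded_clinear (\<lambda>x. - T x)"
    using bounded_clinear_diff[OF bounded_clinear_scaleC[of 0] T(1)] by simp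
  ultimately have "op_invertible (\<lambda>x. (- z) *\<^sub>C x - - T x)"
    using T(2) z(2) by (intro op_invertible_diff[OF bounded_clinear_scaleC]) auto
  then show ?thesis by simp
qed

section \<open>Coordinates of J, numbered by position\<close>

lemma pos_ge_1: "1 \<le> pos (i :: 'n :: {finite, linorder})"
  and pos_le_CARD: "pos (i :: 'n) \<le> CARD('n)"
  using bij_betw_apply[OF bij_betw_pos, of i] by auto

lemma pos_eq_iff: "pos i = pos j \<longleftrightarrow> i = (j :: 'n :: {finite, linorder})"
  using strict_mono_eq[OF pos_strict_mono] .

lemma obtain_pos:
  assumes "1 \<le> k" "k \<le> CARD('n)"
  obtains i :: "'n :: {finite, linorder}" where "pos i = k"
proof -
  have "k \<in> range (pos :: 'n \<Rightarrow> nat)"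
    using assms bij_betw_imp_surj_on[OF bij_betw_pos] by auto
  then show thesis using that by auto
qed

lemma J_op_nth_last:
  assumes i: "pos (i :: 'n :: {finite, linorder}) = CARD('n)" and j: "pos j = 1"
  shows "J_op T v $ i = T (v $ j)"
proof -
  have "J_entry T i k (v $ k) = (if k = j then T (v $ j) else 0)" for k
    using pos_le_CARD[of k] i j pos_eq_iff[of k j] by (auto simp: J_entry_def)
  then show ?thesis by (simp add: J_op_def)
qed

lemma J_op_nth:
  assumes j: "pos j = pos (i :: 'n :: {finite, linorder}) + 1"
  shows "J_op T v $ i = v $ j"
proof -
  have "J_entry T i k (v $ k) = (if k = j then v $ j else 0)" for k
    using pos_le_CARD[of j] j pos_eq_iff[of k j] by (auto simp: J_entry_def)
  then show ?thesis by (simp add: J_op_def)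
qed

text \<open>With vectors written as sequences on positions, J becomes an index shift, and equations
  between neighbouring components become recursions on natural numbers.\<close>

lemma J_op_pos:
  "J_op T (\<chi> i :: 'n :: {finite, linorder}. g (pos i)) =
     (\<chi> i. if pos i = CARD('n) then T (g 1) else g (pos i + 1))"
proof (subst vec_eq_iff, intro allI)
  fix i :: 'n
  show "J_op T (\<chi> i :: 'n. g (pos i)) $ i =
    (\<chi> i. if pos i = CARD('n) then T (g 1) else g (pos i + 1)) $ i"
  proof (cases "pos i = CARD('n)")
    case True
    obtain j :: 'n where j: "pos j = 1"
      by (rule obtain_pos[of 1, where ?'n = 'n]) auto
    show ?thesis
      using J_op_nth_last[OF True j, of T] True j by simp
  next
    case False
    obtain j :: 'n where j: "pos j = pos i + 1"
      using obtain_pos[of "pos i + 1"] False pos_le_CARD[of i]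
      by (metis Suc_eq_plus1 le_add2 not_less_eq_eq order_antisym)
    show ?thesis
      using J_op_nth[OF j, of T] False j by simp
  qed
qed

lemma vec_pos_cases:
  fixes v :: "('a, 'n :: {finite, linorder}) vec"
  obtains g where "v = (\<chi> i. g (pos i))"
proof
  have "inj (pos :: 'n \<Rightarrow> nat)"
    by (rule strict_mono_imp_inj_on[OF pos_strict_mono])
  then show "v = (\<chi> i. (\<lambda>k. v $ inv pos k) (pos i))"
    by (simp add: vec_eq_iff)
qed

lemma norm_pos_single:
  "norm (\<chi> i :: 'n :: {finite, linorder}. if pos i = CARD('n) then y else 0) = norm (y :: 'a :: complex_inner)"
proof -
  obtain l :: 'n where l: "pos l = CARD('n)"
    by (rule obtain_pos[of "CARD('n)", where ?'n = 'n]) auto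
  have "(norm (if pos i = CARD('n) then y else 0))\<^sup>2 = (if i = l then (norm y)\<^sup>2 else 0)" for i :: 'n
    by (simp add: pos_eq_iff flip: l)
  then show ?thesis by (simp add: norm_vec_def L2_set_def)
qed

lemma power_scaleC_chain:
  assumes "\<And>k. 1 \<le> k \<Longrightarrow> k < m \<Longrightarrow> g (k + 1) = z *\<^sub>C (g k :: 'a :: complex_inner)" "1 \<le> k" "k \<le> m"
  shows "g k = z ^ (k - 1) *\<^sub>C g 1"
  using assms(2,3)
proof (induction k rule: dec_induct)
  case base
  then show ?case by (simp add: scaleC_one)
next
  case (step k)
  then have "z * z ^ (k - 1) = z ^ k"
    by (simp flip: power_Suc)
  with step assms(1)[of k] show ?case
    by (simp add: scaleC_scaleC)
qed

lemma power_power_Suc: "z ^ (m ^ Suc k) = (z ^ (m ^ k)) ^ m" for z :: complex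
  by (metis power_Suc2 power_mult)

section \<open>Transfer between T - z and T - z^n\<close>

text \<open>Unitary equivalence enters as a surjective linear isometry \<open>V\<close> intertwining
  J and T, so estimates for J - z pass to T - z with the same constants.\<close>

locale J_stable =
  fixes T :: "'a :: chilbert_space \<Rightarrow> 'a"
    and V :: "('a, 'n :: {finite, linorder}) vec \<Rightarrow> 'a"
  assumes T: "bounded_clinear T"
    and V: "bounded_clinear V"
    and norm_V: "\<And>v. norm (V v) = norm v"
    and surj_V: "surj V"
    and T_V: "\<And>v. T (V v) = V (J_op T v)"
begin

definition shift :: "complex \<Rightarrow> 'a \<Rightarrow> 'a" where
  "shift z x = T x - z *\<^sub>C x"

definition J_shift :: "complex \<Rightarrow> ('a, 'n) vec \<Rightarrow> ('a, 'n) vec" where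
  "J_shift z v = J_op T v - z *\<^sub>C v"

sublocale T: bounded_linear T
  using T by (simp add: bounded_clinear_def)

sublocale V: bounded_linear V
  using V by (simp add: bounded_clinear_def)

lemma shift_V: "shift z (V v) = V (J_shift z v)"
proof -
  have "V (z *\<^sub>C v) = z *\<^sub>C V v"
    using V by (simp add: bounded_clinear_def)
  then show ?thesis
    by (simp add: shift_def J_shift_def T_V V.diff)
qed

lemma V_eq_iff: "V v = V w \<longleftrightarrow> v = w"
proof
  assume "V v = V w"
  then have "norm (v - w) = 0"
    using norm_V[of "v - w"] by (simp add: V.diff)
  then show "v = w" by simp
qed simp

lemma bounded_clinear_shift_T: "bounded_clinear (shift z)"
  using bounded_clinear_shift[OF T] by (simp add: shift_def[abs_def])

lemma T_scaleC: "T (a *\<^sub>C x) = a *\<^sub>C T x"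
  using T by (simp add: bounded_clinear_def)

lemma J_shift_pos:
  "J_shift z (\<chi> i. g (pos i)) =
     (\<chi> i. if pos i = CARD('n) then T (g 1) - z *\<^sub>C g CARD('n) else g (pos i + 1) - z *\<^sub>C g (pos i))"
  by (simp add: J_shift_def J_op_pos vec_eq_iff scaleC_vec_def)

lemma J_shift_pos_last:
  assumes "\<And>k. 1 \<le> k \<Longrightarrow> k < CARD('n) \<Longrightarrow> g (k + 1) = z *\<^sub>C g k"
    and "T (g 1) - z *\<^sub>C g CARD('n) = y"
  shows "J_shift z (\<chi> i. g (pos i)) = (\<chi> i. if pos i = CARD('n) then y else 0)"
proof -
  have "g (pos i + 1) = z *\<^sub>C g (pos i)" if "pos i \<noteq> CARD('n)" for i :: 'n
    using assms(1)[OF pos_ge_1[of i]] pos_le_CARD[of i] that by simp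
  then show ?thesis
    using assms(2) by (auto simp: J_shift_pos vec_eq_iff)
qed

lemma norm_le_norm_pos:
  assumes "1 \<le> k" "k \<le> CARD('n)"
  shows "norm (g k :: 'a) \<le> norm (\<chi> i :: 'n. g (pos i))"
proof -
  obtain i :: 'n where "pos i = k"
    using obtain_pos[OF assms] by blast
  then show ?thesis
    using Finite_Cartesian_Product.norm_nth_le[of "\<chi> i :: 'n. g (pos i)" i] by simp
qed

text \<open>
  For \<open>v = (x, z x, \<dots>, z\<^bsup>n-1\<^esup> x)\<close> all components of \<open>J_shift z v\<close> vanish except the last, which
  is \<open>shift (z\<^bsup>n\<^esup>) x\<close>. The lower bound \<open>c\<close> is inherited without loss, so that it eventually
  exceeds the distance of \<open>z\<^bsup>n\<^sup>k\<^esup>\<close> from \<open>0\<close> when \<open>\<bar>z\<bar> < 1\<close>.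
\<close>

lemma bounded_below_shift_power:
  assumes "bounded_below c (shift z)"
  shows "bounded_below c (shift (z ^ CARD('n)))"
proof -
  have c: "c > 0" "\<And>x. c * norm x \<le> norm (shift z x)"
    using assms by (auto simp: bounded_below_def)
  have "c * norm x \<le> norm (shift (z ^ CARD('n)) x)" for x
  proof -
    define g where "g k = z ^ (k - 1) *\<^sub>C x" for k :: nat
    let ?v = "\<chi> i :: 'n. g (pos i)"
    have "J_shift z ?v = (\<chi> i. if pos i = CARD('n) then shift (z ^ CARD('n)) x else 0)"
      by (rule J_shift_pos_last)
        (simp_all add: g_def scaleC_scaleC scaleC_one shift_def flip: power_Suc)
    then have "norm (shift z (V ?v)) = norm (shift (z ^ CARD('n)) x)"
      by (simp add: shift_V norm_V norm_pos_single)
    moreover have "norm x \<le> norm ?v"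
      using norm_le_norm_pos[of 1 g] by (simp add: g_def scaleC_one)
    then have "c * norm x \<le> c * norm (V ?v)"
      using c(1) by (simp add: norm_V)
    ultimately show ?thesis
      using c(2)[of "V ?v"] by simp
  qed
  then show ?thesis
    using c(1) by (simp add: bounded_below_def)
qed

text \<open>Solve J - z against a vector supported in the last component. All equations but the last
  force a geometric progression of ratio z; the last one is then the desired equation for T -
  z^n.\<close>

lemma surj_shift_power:
  assumes "surj (shift z)"
  shows "surj (shift (z ^ CARD('n)))"
  unfolding surj_def
proof
  fix y
  obtain v where v: "shift z (V v) = V (\<chi> i. if pos i = CARD('n) then y else 0)"
    using assms surj_V by (metis surjD)
  obtain g where g: "v = (\<chi> i. g (pos i))"
    by (rule vec_pos_cases)
  have eq: "J_shift z (\<chi> i. g (pos i)) = (\<chi> i. if pos i = CARD('n) then y else 0)"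
    using v by (simp add: shift_V V_eq_iff g)
  have chain: "g (k + 1) = z *\<^sub>C g k" if k: "1 \<le> k" "k < CARD('n)" for k
  proof -
    obtain i :: 'n where "pos i = k"
      by (rule obtain_pos[of k, where ?'n = 'n]) (use k in auto)
    then show ?thesis
      using arg_cong[OF eq, of "\<lambda>v. v $ i"] k by (simp add: J_shift_pos)
  qed
  obtain l :: 'n where "pos l = CARD('n)"
    by (rule obtain_pos[of "CARD('n)", where ?'n = 'n]) auto
  then have "T (g 1) - z *\<^sub>C g CARD('n) = y"
    using arg_cong[OF eq, of "\<lambda>v. v $ l"] by (simp add: J_shift_pos)
  moreover have "g CARD('n) = z ^ (CARD('n) - 1) *\<^sub>C g 1"
    by (rule power_scaleC_chain[of "CARD('n)" g z]) (auto intro: chain[simplified])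
  ultimately have "y = shift (z ^ CARD('n)) (g 1)"
    by (simp add: shift_def scaleC_scaleC flip: power_Suc)
  then show "\<exists>x. y = shift (z ^ CARD('n)) x" ..
qed

text \<open>Forward substitution determines all components from the first one, \<open>x\<close>; the
  last equation becomes one for T - z^n and is used to choose \<open>x\<close>.\<close>

lemma surj_shift_root:
  assumes "surj (shift (z ^ CARD('n)))"
  shows "surj (shift z)"
  unfolding surj_def
proof
  fix y
  obtain w where w: "y = V w"
    using surj_V by (metis surjD)
  obtain h where h: "w = (\<chi> i. h (pos i))"
    by (rule vec_pos_cases)
  \<comment> \<open>\<open>q (k - 1)\<close> is the k-th component of the solution of the recursion
    that starts at 0; the homogeneous part z^(k-1) x is added in \<open>g\<close>.\<close>
  define q where "q = rec_nat 0 (\<lambda>k r. h (Suc k) + z *\<^sub>C r)"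
  have q: "q 0 = 0" "\<And>k. q (Suc k) = h (Suc k) + z *\<^sub>C q k"
    by (simp_all add: q_def)
  obtain x where x: "shift (z ^ CARD('n)) x = h CARD('n) + z *\<^sub>C q (CARD('n) - 1)"
    using assms by (metis surjD)
  define g where "g k = z ^ (k - 1) *\<^sub>C x + q (k - 1)" for k
  have "g (k + 1) - z *\<^sub>C g k = h k" if k: "1 \<le> k" for k
    using k q(2)[of "k - 1"]
    by (simp add: g_def scaleC_add_right scaleC_scaleC flip: power_Suc)
  moreover have "T (g 1) - z *\<^sub>C g CARD('n) = h CARD('n)"
    using x by (simp add: g_def scaleC_add_right scaleC_scaleC scaleC_one q(1) shift_def
        algebra_simps flip: power_Suc)
  ultimately have "J_shift z (\<chi> i. g (pos i)) = w"
    using pos_ge_1 by (auto simp: J_shift_pos vec_eq_iff h)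
  then have "y = shift z (V (\<chi> i. g (pos i)))"
    by (simp add: shift_V w)
  then show "\<exists>x. y = shift z x" ..
qed

text \<open>The deviation from the geometric progression with the same first component obeys a
  recursion: at k+1 it is the k-th component of \<open>J_shift\<close> plus z times the deviation at
  k. The constant is uniform in \<open>g\<close>.\<close>

lemma J_shift_recursion_bound:
  assumes "1 \<le> k" "k \<le> CARD('n)"
  shows "\<exists>K. \<forall>g. norm (g k - z ^ (k - 1) *\<^sub>C g 1) \<le> K * norm (J_shift z (\<chi> i :: 'n. g (pos i)))"
  using assms
proof (induction k rule: dec_induct)
  case base
  show ?case by (simp add: scaleC_one) (metis mult_zero_left order_refl)
next
  case (step k)
  then obtain K where K:
    "\<And>g. norm (g k - z ^ (k - 1) *\<^sub>C g 1) \<le> K * norm (J_shift z (\<chi> i :: 'n. g (pos i)))"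
    by auto
  have "norm (g (Suc k) - z ^ (Suc k - 1) *\<^sub>C g 1) \<le>
      (1 + cmod z * K) * norm (J_shift z (\<chi> i :: 'n. g (pos i)))" for g
  proof -
    let ?u = "J_shift z (\<chi> i :: 'n. g (pos i))"
    obtain i :: 'n where i: "pos i = k"
      by (rule obtain_pos[of k, where ?'n = 'n]) (use step in auto)
    have "z * z ^ (k - 1) = z ^ k"
      using step(1) by (simp flip: power_Suc)
    then have "g (Suc k) - z ^ (Suc k - 1) *\<^sub>C g 1 = ?u $ i + z *\<^sub>C (g k - z ^ (k - 1) *\<^sub>C g 1)"
      using i step by (simp add: J_shift_pos complex_vector.scale_right_diff_distrib scaleC_scaleC)
    also have "norm \<dots> \<le> norm ?u + cmod z * (K * norm ?u)"
      by (intro norm_triangle_mono Finite_Cartesian_Product.norm_nth_le)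
        (simp add: norm_scaleC mult_left_mono K[simplified])
    finally show ?thesis by (simp add: algebra_simps)
  qed
  then show ?case
    by blast
qed

text \<open>The last equation and the lower bound of T - z^n control the first component; the
  recursion bound then controls all the others.\<close>

lemma bounded_below_shift_root:
  assumes "bounded_below c (shift (z ^ CARD('n)))"
  shows "\<exists>d. bounded_below d (shift z)"
proof -
  have c: "c > 0" "\<And>x. c * norm x \<le> norm (shift (z ^ CARD('n)) x)"
    using assms by (auto simp: bounded_below_def)
  let ?u = "\<lambda>g. J_shift z (\<chi> i :: 'n. g (pos i))"
  have "\<exists>K. \<forall>k\<in>{1..CARD('n)}. \<forall>g. norm (g k - z ^ (k - 1) *\<^sub>C g 1) \<le> K k * norm (?u g)"
    using J_shift_recursion_bound by (intro bchoice) auto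
  then obtain K where K:
    "\<And>k g. 1 \<le> k \<Longrightarrow> k \<le> CARD('n) \<Longrightarrow> norm (g k - z ^ (k - 1) *\<^sub>C g 1) \<le> K k * norm (?u g)"
    by (metis atLeastAtMost_iff)
  have n: "1 \<le> CARD('n)"
    by (simp add: Suc_le_eq)
  \<comment> \<open>By the last equation, \<open>shift (z ^ CARD('n)) (g 1)\<close> is the last
    component of \<open>?u g\<close> plus z times the deviation of
    \<open>g CARD('n)\<close>.\<close>
  define C where "C = (1 + cmod z * K CARD('n)) / c"
  have C: "norm (g 1) \<le> C * norm (?u g)" for g
  proof -
    obtain l :: 'n where l: "pos l = CARD('n)"
      by (rule obtain_pos[of "CARD('n)", where ?'n = 'n]) auto
    have "shift (z ^ CARD('n)) (g 1) = ?u g $ l + z *\<^sub>C (g CARD('n) - z ^ (CARD('n) - 1) *\<^sub>C g 1)"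
      using l by (simp add: J_shift_pos shift_def complex_vector.scale_right_diff_distrib
          scaleC_scaleC flip: power_Suc)
    also have "norm \<dots> \<le> norm (?u g) + cmod z * (K CARD('n) * norm (?u g))"
      by (intro norm_triangle_mono Finite_Cartesian_Product.norm_nth_le)
        (simp add: norm_scaleC mult_left_mono K[OF n order_refl, simplified])
    finally have "c * norm (g 1) \<le> (1 + cmod z * K CARD('n)) * norm (?u g)"
      using c(2)[of "g 1"] by (simp add: algebra_simps)
    then show ?thesis
      using c(1) by (simp add: C_def field_simps)
  qed
  define M where "M k = K k + cmod z ^ (k - 1) * C" for k
  have M: "norm (g k) \<le> M k * norm (?u g)" if "1 \<le> k" "k \<le> CARD('n)" for k g
  proof -
    have "norm (g k) \<le> norm (g k - z ^ (k - 1) *\<^sub>C g 1) + norm (z ^ (k - 1) *\<^sub>C g 1)"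
      using norm_triangle_ineq[of "g k - z ^ (k - 1) *\<^sub>C g 1" "z ^ (k - 1) *\<^sub>C g 1"] by simp
    also have "\<dots> \<le> K k * norm (?u g) + cmod z ^ (k - 1) * (C * norm (?u g))"
      by (intro add_mono K that) (simp add: norm_scaleC norm_power mult_left_mono C[simplified])
    finally show ?thesis by (simp add: M_def algebra_simps)
  qed
  define D where "D = (\<Sum>i\<in>(UNIV :: 'n set). M (pos i))"
  have D: "norm v \<le> D * norm (J_shift z v)" for v
  proof -
    obtain g where g: "v = (\<chi> i. g (pos i))"
      by (rule vec_pos_cases)
    have "norm v \<le> (\<Sum>i\<in>UNIV. norm (v $ i))"
      unfolding norm_vec_def by (rule L2_set_le_sum) simp
    also have "\<dots> \<le> (\<Sum>i\<in>(UNIV :: 'n set). M (pos i) * norm (J_shift z v))"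
      unfolding g by (intro sum_mono) (use M[OF pos_ge_1 pos_le_CARD, of g] in simp)
    finally show ?thesis by (simp add: D_def sum_distrib_right)
  qed
  \<comment> \<open>\<open>\<bar>D\<bar> + 1\<close> replaces \<open>D\<close> to make the
    denominator positive.\<close>
  have "1 / (\<bar>D\<bar> + 1) * norm x \<le> norm (shift z x)" for x
  proof -
    obtain v where v: "x = V v"
      using surj_V by (metis surjD)
    have "norm v \<le> (\<bar>D\<bar> + 1) * norm (J_shift z v)"
      by (rule order_trans[OF D mult_right_mono]) auto
    then show ?thesis
      by (simp add: v shift_V norm_V field_simps)
  qed
  then have "bounded_below (1 / (\<bar>D\<bar> + 1)) (shift z)"
    by (simp add: bounded_below_def)
  then show ?thesis ..
qed

lemma op_invertible_shift_iff:
  "op_invertible (shift z) \<longleftrightarrow> (\<exists>c. bounded_below c (shift z)) \<and> surj (shift z)"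
  by (rule op_invertible_iff[OF bounded_clinear_shift_T])

lemma op_invertible_shift_root:
  "op_invertible (shift (z ^ CARD('n))) \<Longrightarrow> op_invertible (shift z)"
  using bounded_below_shift_root surj_shift_root unfolding op_invertible_shift_iff by blast

lemma op_invertible_shift_iterated_root:
  "op_invertible (shift (z ^ (CARD('n) ^ k))) \<Longrightarrow> op_invertible (shift z)"
proof (induction k)
  case (Suc k)
  then show ?case
    using op_invertible_shift_root[of "z ^ (CARD('n) ^ k)"] by (simp only: power_power_Suc)
qed simp

lemma shift_iterated_power:
  assumes "bounded_below c (shift z)" "surj (shift z)"
  shows "bounded_below c (shift (z ^ (CARD('n) ^ k))) \<and> surj (shift (z ^ (CARD('n) ^ k)))"
proof (induction k)
  case (Suc k)
  then show ?case
    using bounded_below_shift_power[of c "z ^ (CARD('n) ^ k)"] surj_shift_power[of "z ^ (CARD('n) ^ k)"]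
    by (simp only: power_power_Suc)
qed (use assms in simp)

text \<open>
  The vector \<open>v\<close> in this proof is found by differentiating the identity behind
  \<open>bounded_below_shift_power\<close> with respect to \<open>z\<close>: it solves
  \<open>J_shift z v = (x, z x, \<dots>, z\<^bsup>n-1\<^esup> x)\<close> with \<open>x = shift (z\<^bsup>n\<^esup>) y\<close>, and its first component is
  \<open>n z\<^bsup>n-1\<^esup> y\<close>; the factor \<open>n\<close> comes from the derivative of \<open>z\<^bsup>n\<^esup>\<close>.
\<close>

lemma shift_square_bound_power:
  assumes z: "cmod z = 1" and c: "\<And>x. c * norm x \<le> norm (shift z (shift z x))" "c \<ge> 0"
  shows "real CARD('n) * c * norm y \<le> norm (shift (z ^ CARD('n)) (shift (z ^ CARD('n)) y))"
proof -
  let ?n = "CARD('n)"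
  define x where "x = shift (z ^ ?n) y"
  \<comment> \<open>The first summand is the derivative of z^(k-1) x; in the last equation it falls
    short by n z^(n-1) x, which the second summand supplies since x =
    \<open>shift (z ^ ?n) y\<close>. At k = 1 the truncated exponent \<open>k - 2\<close> is
    harmless because its coefficient is 0.\<close>
  define g where "g k = (of_nat (k - 1) * z ^ (k - 2)) *\<^sub>C x + (of_nat ?n * z ^ (?n + k - 2)) *\<^sub>C y"
    for k :: nat
  define h where "h k = z ^ (k - 1) *\<^sub>C x" for k :: nat
  let ?v = "\<chi> i :: 'n. g (pos i)"
  have n: "?n > 0" by simp
  have "g (k + 1) - z *\<^sub>C g k = h k" if k: "1 \<le> k" for k
  proof -
    obtain j where j: "k = Suc j"
      using k by (cases k) auto
    obtain m where m: "?n = Suc m"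
      using n by (cases ?n) auto
    have "z * (of_nat j * z ^ (j - 1)) = of_nat j * z ^ j"
      by (cases j) simp_all
    then have "z *\<^sub>C g k = (of_nat j * z ^ j) *\<^sub>C x + (of_nat ?n * z ^ (?n + j)) *\<^sub>C y"
      by (simp add: g_def j m scaleC_add_right scaleC_scaleC ac_simps)
    moreover have "g (k + 1) = (of_nat (Suc j) * z ^ j) *\<^sub>C x + (of_nat ?n * z ^ (?n + j)) *\<^sub>C y"
      by (simp add: g_def j)
    moreover have "(of_nat (Suc j) * z ^ j) *\<^sub>C x = (of_nat j * z ^ j) *\<^sub>C x + z ^ j *\<^sub>C x"
      by (simp add: algebra_simps flip: scaleC_add_left)
    ultimately show ?thesis
      by (simp add: h_def j)
  qed
  moreover have "T (g 1) - z *\<^sub>C g ?n = h ?n"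
  proof -
    obtain m where m: "?n = Suc m"
      using n by (cases ?n) auto
    have zm: "z * (of_nat m * z ^ (m - 1)) = of_nat m * z ^ m"
      by (cases m) simp_all
    have "T y = x + z ^ ?n *\<^sub>C y"
      by (simp add: x_def shift_def)
    then have "T (g 1) = (of_nat (Suc m) * z ^ m) *\<^sub>C x + (of_nat (Suc m) * z ^ (m + Suc m)) *\<^sub>C y"
      by (simp add: g_def m T_scaleC scaleC_add_right scaleC_scaleC power_add ac_simps)
    moreover have "z *\<^sub>C g ?n = (of_nat m * z ^ m) *\<^sub>C x + (of_nat (Suc m) * z ^ (m + Suc m)) *\<^sub>C y"
      using zm by (simp add: g_def m scaleC_add_right scaleC_scaleC ac_simps)
    moreover have "(of_nat (Suc m) * z ^ m) *\<^sub>C x = (of_nat m * z ^ m) *\<^sub>C x + z ^ m *\<^sub>C x"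
      by (simp add: algebra_simps flip: scaleC_add_left)
    ultimately show ?thesis
      by (simp add: h_def m)
  qed
  ultimately have "J_shift z ?v = (\<chi> i. h (pos i))"
    using pos_ge_1 by (auto simp: J_shift_pos vec_eq_iff)
  moreover have "J_shift z (\<chi> i. h (pos i)) = (\<chi> i. if pos i = ?n then shift (z ^ ?n) x else 0)"
    by (rule J_shift_pos_last)
      (simp_all add: h_def scaleC_scaleC scaleC_one shift_def flip: power_Suc)
  \<comment> \<open>The first application of \<open>J_shift z\<close> yields the geometric vector
    \<open>h\<close>, the second leaves only its last component.\<close>
  ultimately have "norm (shift z (shift z (V ?v))) = norm (shift (z ^ ?n) x)"
    by (simp add: shift_V norm_V norm_pos_single)
  then have "c * norm ?v \<le> norm (shift (z ^ ?n) x)"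
    using c(1)[of "V ?v"] by (simp add: norm_V)
  moreover have "real ?n * norm y \<le> norm ?v"
    using norm_le_norm_pos[of 1 g] z by (simp add: g_def norm_scaleC norm_mult norm_power)
  then have "c * (real ?n * norm y) \<le> c * norm ?v"
    using c(2) by (rule mult_left_mono)
  ultimately show ?thesis
    by (simp add: x_def ac_simps)
qed

section \<open>Circle, exterior and interior\<close>

text \<open>A bound of T - z merely persists along the iterates, hence the square: its bound grows
  like n^k c^2, while (T - w)^2 stays below (K + 1)^2 for every w on the circle. Testing on
  \<open>y\<close> gives the contradiction.\<close>

lemma not_op_invertible_shift_sphere:
  assumes nontrivial: "(y :: 'a) \<noteq> 0" and n: "CARD('n) \<ge> 2" and z: "cmod z = 1"
  shows "\<not> op_invertible (shift z)"
proof
  assume "op_invertible (shift z)"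
  then obtain c where c: "c > 0" "\<And>x. c * norm x \<le> norm (shift z x)"
    by (auto simp: op_invertible_shift_iff bounded_below_def)
  obtain K where K: "K > 0" "\<And>x. norm (T x) \<le> norm x * K"
    using T.pos_bounded by blast
  have lower: "real (CARD('n) ^ k) * c\<^sup>2 * norm x \<le>
    norm (shift (z ^ (CARD('n) ^ k)) (shift (z ^ (CARD('n) ^ k)) x))" for k x
  proof (induction k arbitrary: x)
    case 0
    have "c * (c * norm x) \<le> c * norm (shift z x)"
      using c by (intro mult_left_mono) auto
    also have "\<dots> \<le> norm (shift z (shift z x))" by (rule c(2))
    finally show ?case by (simp add: power2_eq_square ac_simps)
  next
    case (Suc k)
    then show ?case
      using shift_square_bound_power[of "z ^ (CARD('n) ^ k)" "real (CARD('n) ^ k) * c\<^sup>2" x] z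
      unfolding power_power_Suc by (simp add: ac_simps norm_power)
  qed
  have upper: "norm (shift w x) \<le> (K + 1) * norm x" if "cmod w = 1" for w x
    using norm_triangle_ineq4[of "T x" "w *\<^sub>C x"] K(2)[of x] that
    by (simp add: shift_def norm_scaleC algebra_simps)
  have "real (CARD('n) ^ k) * c\<^sup>2 * norm y \<le> (K + 1) * ((K + 1) * norm y)" for k
  proof -
    have w: "cmod (z ^ (CARD('n) ^ k)) = 1"
      using z by (simp add: norm_power)
    show ?thesis
      using K(1) by (intro order_trans[OF lower] order_trans[OF upper[OF w]] mult_left_mono upper[OF w]) auto
  qed
  then have "(real (CARD('n) ^ k) * c\<^sup>2) * norm y \<le> (K + 1)\<^sup>2 * norm y" for k
    by (simp only: power2_eq_square mult.assoc)
  then have bound: "real (CARD('n) ^ k) \<le> (K + 1)\<^sup>2 / c\<^sup>2" for k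
    using c(1) nontrivial by (subst pos_le_divide_eq) (auto dest: mult_right_le_imp_le)
  obtain k where "(K + 1)\<^sup>2 / c\<^sup>2 < real CARD('n) ^ k"
    using real_arch_pow[of "real CARD('n)"] n by auto
  with bound[of k] show False by simp
qed

lemma op_invertible_shift_outside:
  assumes n: "CARD('n) \<ge> 2" and z: "cmod z > 1"
  shows "op_invertible (shift z)"
proof -
  obtain K where K: "K > 0" "\<And>x. norm (T x) \<le> norm x * K"
    using T.pos_bounded by blast
  obtain k where "K < cmod z ^ k"
    using real_arch_pow[OF z] by blast
  \<comment> \<open>Here k \<le> n^k is used, valid since n \<ge> 2.\<close>
  also have "\<dots> \<le> cmod z ^ (CARD('n) ^ k)"
    using z n by (intro power_increasing) (auto intro!: less_imp_le self_le_ge2_pow)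
  finally have "op_invertible (shift (z ^ (CARD('n) ^ k)))"
    unfolding shift_def[abs_def] using z K
    by (intro op_invertible_shift_large[OF T]) (auto simp: norm_power mult.commute)
  then show ?thesis by (rule op_invertible_shift_iterated_root)
qed

lemma power_CARD_small:
  assumes n: "CARD('n) \<ge> 2" and z: "cmod z < 1" and c: "c > 0"
  obtains k where "cmod (z ^ (CARD('n) ^ k)) < c"
proof -
  obtain k where k: "cmod z ^ k < c"
    using real_arch_pow_inv[OF c z] by blast
  have "cmod z ^ (CARD('n) ^ k) \<le> cmod z ^ k"
    using z n by (intro power_decreasing) (auto intro!: less_imp_le self_le_ge2_pow)
  with k show thesis by (intro that[of k]) (simp add: norm_power)
qed

lemma op_invertible_shift_inside_iff:
  assumes n: "CARD('n) \<ge> 2" and z: "cmod z < 1"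
  shows "op_invertible (shift z) \<longleftrightarrow> op_invertible T"
proof
  assume "op_invertible (shift z)"
  then obtain c where c: "bounded_below c (shift z)" "surj (shift z)"
    by (auto simp: op_invertible_shift_iff)
  then have "c > 0" by (simp add: bounded_below_def)
  then obtain k where k: "cmod (z ^ (CARD('n) ^ k)) < c"
    using power_CARD_small[OF n z] by blast
  let ?w = "z ^ (CARD('n) ^ k)"
  \<comment> \<open>T is recovered from T - w by adding back w, a perturbation smaller than the
    persisting lower bound \<open>c\<close>.\<close>
  have "op_invertible (\<lambda>x. shift ?w x - (- ?w) *\<^sub>C x)"
    using shift_iterated_power[OF c, of k] k
    by (intro op_invertible_shift_bounded_below[OF bounded_clinear_shift_T]) auto
  then show "op_invertible T" by (simp add: shift_def)
next
  assume "op_invertible T"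
  then obtain c where c: "bounded_below c T" "surj T"
    by (auto simp: op_invertible_iff[OF T])
  then have "c > 0" by (simp add: bounded_below_def)
  then obtain k where "cmod (z ^ (CARD('n) ^ k)) < c"
    using power_CARD_small[OF n z] by blast
  \<comment> \<open>Conversely T - w is a small perturbation of T, and invertibility is pulled back
    from w to its iterated root z.\<close>
  then have "op_invertible (shift (z ^ (CARD('n) ^ k)))"
    unfolding shift_def[abs_def] using c by (intro op_invertible_shift_bounded_below[OF T])
  then show "op_invertible (shift z)" by (rule op_invertible_shift_iterated_root)
qed

lemma op_spectrum_T: "op_spectrum T = {z. \<not> op_invertible (shift z)}"
  by (simp add: op_spectrum_def shift_def[abs_def])

end

section \<open>The dichotomy for the spectrum\<close>

theorem corollary2p10:
  fixes T :: "'a :: chilbert_space \<Rightarrow> 'a"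
  assumes separable: "separable_space (euclidean :: 'a topology)"
    and infinite_dimensional: "infinite_cdim TYPE('a)"
    and n_ge_2: "CARD('n :: {finite, linorder}) \<ge> 2"
    and T_bounded: "bounded_clinear T"
    and T_stable: "unitarily_equivalent T (J_op T :: ('a, 'n) vec \<Rightarrow> ('a, 'n) vec)"
  shows "(op_invertible T \<and> op_spectrum T = sphere 0 1) \<or>
         (\<not> op_invertible T \<and> op_spectrum T = cball 0 1)"
proof -
  obtain V :: "('a, 'n) vec \<Rightarrow> 'a" where V: "cunitary V" "J_op T = cadjoint V \<circ> T \<circ> V"
    using T_stable by (auto simp: unitarily_equivalent_def)
  then have V': "V (cadjoint V x) = x" "cadjoint V (V v) = v" for x v
    by (simp_all add: cunitary_def pointfree_idE)
  interpret J_stable T V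
  proof
    show "norm (V v) = norm v" for v
      using V(1) by (simp add: norm_eq_sqrt_cinner cunitary_def is_cadjoint_def V'(2))
    show "surj V"
      by (rule surjI) (rule V'(1))
    show "T (V v) = V (J_op T v)" for v
      by (simp add: V(2) V'(1))
  qed (use T_bounded V(1) in \<open>simp_all add: cunitary_def\<close>)
  \<comment> \<open>A space without nonzero vectors is spanned by the empty set.\<close>
  obtain y :: 'a where y: "y \<noteq> 0"
  proof (rule ccontr)
    assume "\<not> thesis"
    then have "cspan {} = (UNIV :: 'a set)"
      using that by (metis UNIV_eq_I complex_vector.span_zero)
    with infinite_dimensional show False
      unfolding infinite_cdim_def by blast
  qed
  have out: "op_invertible (shift z)" if "cmod z > 1" for z
    using op_invertible_shift_outside[OF n_ge_2 that] .
  have on: "\<not> op_invertible (shift z)" if "cmod z = 1" for z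
    using not_op_invertible_shift_sphere[OF y n_ge_2 that] .
  have ins: "op_invertible (shift z) \<longleftrightarrow> op_invertible T" if "cmod z < 1" for z
    using op_invertible_shift_inside_iff[OF n_ge_2 that] .
  have "op_spectrum T = (if op_invertible T then sphere 0 1 else cball 0 1)"
  proof (rule set_eqI)
    fix z :: complex
    consider "cmod z < 1" | "cmod z = 1" | "cmod z > 1" by linarith
    then show "z \<in> op_spectrum T \<longleftrightarrow> z \<in> (if op_invertible T then sphere 0 1 else cball 0 1)"
      by cases (auto simp: op_spectrum_T out on ins)
  qed
  then show ?thesis by auto
qed

end
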